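(* Let $\mathcal A$ be a $C^*$-algebra and $\mathcal X$ a Hilbert $\mathcal A$-module, and let $f:\mathcal X\to\mathcal X$ be a non-adjointable bounded $\mathcal A$-linear mapping. Then there do not exist a function $\varphi:\mathcal X\times\mathcal X\to[0,\infty)$, an everywhere defined (not necessarily linear) mapping $g:\mathcal X\to\mathcal X$ and a sequence $\{c_n\}$ of non-zero complex numbers such that $$\|\langle f(x),y\rangle-\langle x,g(y)\rangle\|\le\varphi(x,y)\qquad(x,y\in\mathcal X)$$ and such that either both of the conditions $$\lim_{n\to\infty}|c_n|^{-1}\varphi(c_nx,y)=0\quad\text{and}\quad \lim_{n\to\infty}|c_n|^{-1}\varphi(x,c_ny)=0\qquad(x,y\in\mathcal X)$$ hold, or both of the conditions $$\lim_{n\to\infty}|c_n|\,\varphi(c_n^{-1}x,y)=0\quad\text{and}\quad \lim_{n\to\infty}|c_n|\,\varphi(x,c_n^{-1}y)=0\qquad(x,y\in\mathcal X)$$ hold.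
   Context: A (right) Hilbert $\mathcal A$-module is a complex linear space $\mathcal X$ that is a right $\mathcal A$-module with $\lambda(xa)=x(\lambda a)=(\lambda x)a$ for $x\in\mathcal X$, $a\in\mathcal A$, $\lambda\in\mathbb C$, equipped with an $\mathcal A$-valued inner product $\langle\cdot,\cdot\rangle:\mathcal X\times\mathcal X\to\mathcal A$ satisfying: (i) $\langle x,x\rangle\ge0$, with $\langle x,x\rangle=0$ iff $x=0$; (ii) $\langle x,y+\lambda z\rangle=\langle x,y\rangle+\lambda\langle x,z\rangle$; (iii) $\langle x,ya\rangle=\langle x,y\rangle a$; (iv) $\langle x,y\rangle^*=\langle y,x\rangle$; and complete for the norm $\|x\|=\|\langle x,x\rangle\|^{1/2}$. An everywhere defined mapping $f:\mathcal X\to\mathcal X$ is called adjointable if there is a mapping $g:\mathcal X\to\mathcal X$ with $\langle f(x),y\rangle=\langle x,g(y)\rangle$ for all $x,y\in\mathcal X$. *)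

theory Defs
  imports "HOL-Analysis.Analysis"
begin

text \<open>
  Neither the algebra nor its modules are assumed to be unital, and both may be zero.
\<close>

class cstar_algebra = banach + real_normed_algebra +
  fixes scaleC :: "complex \<Rightarrow> 'a \<Rightarrow> 'a"  (infixr "*\<^sub>C" 75)
    and star :: "'a \<Rightarrow> 'a"
  assumes scaleC_add_right: "c *\<^sub>C (a + b) = c *\<^sub>C a + c *\<^sub>C b"
    and scaleC_add_left: "(c + d) *\<^sub>C a = c *\<^sub>C a + d *\<^sub>C a"
    and scaleC_scaleC: "c *\<^sub>C d *\<^sub>C a = (c * d) *\<^sub>C a"
    and scaleC_of_real: "complex_of_real r *\<^sub>C a = r *\<^sub>R a"
    and mult_scaleC_left: "(c *\<^sub>C a) * b = c *\<^sub>C (a * b)"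
    and mult_scaleC_right: "a * (c *\<^sub>C b) = c *\<^sub>C (a * b)"
    and norm_scaleC: "norm (c *\<^sub>C a) = cmod c * norm a"
    and star_star: "star (star a) = a"
    and star_add: "star (a + b) = star a + star b"
    and star_scaleC: "star (c *\<^sub>C a) = cnj c *\<^sub>C star a"
    and star_mult: "star (a * b) = star b * star a"
    and cstar_identity: "norm (star a * a) = (norm a)\<^sup>2"

definition cstar_positive :: "'a::cstar_algebra \<Rightarrow> bool" where
  "cstar_positive a \<longleftrightarrow> (\<exists>b. a = star b * b)"

definition module_norm :: "('x \<Rightarrow> 'x \<Rightarrow> 'a::cstar_algebra) \<Rightarrow> 'x \<Rightarrow> real" where
  "module_norm ip x = sqrt (norm (ip x x))"

locale hilbert_module = vector_space scale
  for scale :: "complex \<Rightarrow> 'x::ab_group_add \<Rightarrow> 'x" +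
  fixes act :: "'x \<Rightarrow> 'a::cstar_algebra \<Rightarrow> 'x"
    and ip :: "'x \<Rightarrow> 'x \<Rightarrow> 'a"
  assumes act_add_left: "act (x + y) a = act x a + act y a"
    and act_add_right: "act x (a + b) = act x a + act x b"
    and act_mult: "act x (a * b) = act (act x a) b"
    and scale_act: "scale c (act x a) = act x (c *\<^sub>C a)"
    and act_scale: "act x (c *\<^sub>C a) = act (scale c x) a"
    and ip_positive: "cstar_positive (ip x x)"
    and ip_eq_0_iff: "ip x x = 0 \<longleftrightarrow> x = 0"
    and ip_linear_right: "ip x (y + scale c z) = ip x y + c *\<^sub>C ip x z"
    and ip_act_right: "ip x (act y a) = ip x y * a"
    and star_ip: "star (ip x y) = ip y x"
    and complete:
      "(\<forall>e>0. \<exists>N. \<forall>m\<ge>N. \<forall>n\<ge>N. module_norm ip (s m - s n) < e) \<Longrightarrow>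
         \<exists>l. (\<lambda>n. module_norm ip (s n - l)) \<longlonglongrightarrow> 0"

text \<open>
  Complex homogeneity is not part of the following definition: on a Hilbert module it
  follows from the two conditions, because \<open>z = 0\<close> whenever \<open>act z a = 0\<close> for all \<open>a\<close>.
\<close>

definition module_linear ::
    "('x::ab_group_add \<Rightarrow> 'a::cstar_algebra \<Rightarrow> 'x) \<Rightarrow> ('x \<Rightarrow> 'x) \<Rightarrow> bool" where
  "module_linear act f \<longleftrightarrow>
     (\<forall>x y. f (x + y) = f x + f y) \<and> (\<forall>x a. f (act x a) = act (f x) a)"

definition module_bounded :: "('x \<Rightarrow> 'x \<Rightarrow> 'a::cstar_algebra) \<Rightarrow> ('x \<Rightarrow> 'x) \<Rightarrow> bool" where
  "module_bounded ip f \<longleftrightarrow> (\<exists>K. \<forall>x. module_norm ip (f x) \<le> K * module_norm ip x)"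

definition adjointable :: "('x \<Rightarrow> 'x \<Rightarrow> 'a::cstar_algebra) \<Rightarrow> ('x \<Rightarrow> 'x) \<Rightarrow> bool" where
  "adjointable ip f \<longleftrightarrow> (\<exists>g. \<forall>x y. ip (f x) y = ip x (g y))"

end

theory Submission
  imports Defs
begin

text \<open>
  The map \<open>f\<close> is complex homogeneous, so \<open>ip (f x) y - ip x (g y)\<close> is conjugate homogeneous
  in \<open>x\<close>, for fixed \<open>y\<close>. Replacing \<open>x\<close> by \<open>c x\<close> therefore multiplies the norm of this defect
  by \<open>\<bar>c\<bar>\<close>, and the defect at \<open>(x, y)\<close> is at most \<open>\<bar>c\<bar>\<inverse> \<phi> (c x) y\<close>. Along scalars for which
  this bound tends to \<open>0\<close> the defect, which does not depend on \<open>c\<close>, must vanish; that is,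
  \<open>g\<close> is an adjoint of \<open>f\<close>. The scalars are \<open>c n\<close> under the first pair of
  limit conditions and their inverses under the second pair.

  The homogeneity of \<open>f\<close> comes from its linearity over the algebra. The algebra may lack a unit
  whose multiples could represent the scalars; instead, \<open>f (scale c x)\<close> and \<open>scale c (f x)\<close>
  are compared after multiplication by an arbitrary \<open>a\<close>, where \<open>c\<close> can be absorbed into
  \<open>a\<close>, and an element annihilated by the whole algebra is zero (\<open>eq_0_if_annihilated\<close>).
\<close>

context hilbert_module
begin

lemma ip_zero_right: "ip x 0 = 0"
proof -
  have one: "1 *\<^sub>C a = a" for a :: 'a
    using scaleC_of_real[of 1 a] by simp
  have "ip x 0 = ip x 0 + ip x 0"
    using ip_linear_right[of x 0 1 0] by (simp add: one)
  then show ?thesis by simp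
qed

lemma ip_scale_right: "ip x (scale c y) = c *\<^sub>C ip x y"
  using ip_linear_right[of x 0 c y] by (simp add: ip_zero_right)

lemma ip_scale_left: "ip (scale c x) y = cnj c *\<^sub>C ip x y"
proof -
  have "ip (scale c x) y = star (c *\<^sub>C ip y x)"
    by (simp add: star_ip flip: ip_scale_right)
  then show ?thesis
    by (simp add: star_scaleC star_ip)
qed

text \<open>
  The relevant multiplier is \<open>ip z z\<close> itself: it is self-adjoint, so its square has norm
  \<open>(norm (ip z z))\<^sup>2\<close> by the C*-identity, while that square is \<open>ip z (act z (ip z z))\<close>.
\<close>

lemma eq_0_if_annihilated:
  assumes "\<And>a. act z a = 0"
  shows "z = 0"
proof -
  have "star (ip z z) * ip z z = ip z (act z (ip z z))"
    by (simp add: star_ip ip_act_right)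
  also have "\<dots> = 0"
    by (simp add: assms ip_zero_right)
  finally have "(norm (ip z z))\<^sup>2 = 0"
    by (simp flip: cstar_identity)
  then show ?thesis
    by (simp add: ip_eq_0_iff)
qed

lemma module_linear_scale:
  assumes "module_linear act f"
  shows "f (scale c x) = scale c (f x)"
proof -
  have f_act: "f (act u a) = act (f u) a" for u a
    using assms by (simp add: module_linear_def)
  have "act (f (scale c x) - scale c (f x)) a = 0" for a
  proof -
    have "act (f (scale c x)) a = act (scale c (f x)) a"
      by (simp add: f_act flip: f_act act_scale)
    then show ?thesis
      using act_add_left[of "f (scale c x) - scale c (f x)" "scale c (f x)" a] by simp
  qed
  then show ?thesis
    using eq_0_if_annihilated by fastforce
qed

lemma norm_adjoint_defect_scale:
  assumes "module_linear act f"
  shows "norm (ip (f (scale d x)) y - ip (scale d x) z) = cmod d * norm (ip (f x) y - ip x z)"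
proof -
  have diff: "e *\<^sub>C (a - b) = e *\<^sub>C a - e *\<^sub>C b" for e and a b :: 'a
    using scaleC_add_right[of e "a - b" b] by (simp add: algebra_simps)
  have "ip (f (scale d x)) y - ip (scale d x) z = cnj d *\<^sub>C (ip (f x) y - ip x z)"
    by (simp add: module_linear_scale[OF assms] ip_scale_left diff)
  then show ?thesis
    by (simp add: norm_scaleC)
qed

text \<open>
  Scaling the first variable leaves the vector \<open>g y\<close> in place, so the defect is scaled exactly
  by \<open>\<bar>d n\<bar>\<close> and the factor \<open>inverse (cmod (d n))\<close> cancels it.
\<close>

lemma adjointable_if_approx_adjoint:
  assumes lin: "module_linear act f"
    and nz: "\<And>n. d n \<noteq> 0"
    and bound: "\<And>x y. norm (ip (f x) y - ip x (g y)) \<le> \<phi> x y"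
    and lim: "\<And>x y. (\<lambda>n. inverse (cmod (d n)) * \<phi> (scale (d n) x) y) \<longlonglongrightarrow> 0"
  shows "adjointable ip f"
proof -
  have "ip (f x) y = ip x (g y)" for x y
  proof -
    have le: "norm (ip (f x) y - ip x (g y)) \<le> inverse (cmod (d n)) * \<phi> (scale (d n) x) y" for n
      using bound[of "scale (d n) x" y] nz[of n]
      by (simp add: norm_adjoint_defect_scale[OF lin] field_simps)
    have "norm (ip (f x) y - ip x (g y)) \<le> 0"
      by (rule LIMSEQ_le_const[OF lim]) (use le in blast)
    then show ?thesis by simp
  qed
  then show ?thesis
    unfolding adjointable_def by blast
qed

end

theorem corollary2p9:
  fixes scale :: "complex \<Rightarrow> 'x::ab_group_add \<Rightarrow> 'x"
    and act :: "'x \<Rightarrow> 'a::cstar_algebra \<Rightarrow> 'x"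
    and ip :: "'x \<Rightarrow> 'x \<Rightarrow> 'a"
    and f :: "'x \<Rightarrow> 'x"
  assumes "hilbert_module scale act ip"
    and "module_linear act f"
    and "module_bounded ip f"
    and "\<not> adjointable ip f"
  shows "\<not> (\<exists>(\<phi> :: 'x \<Rightarrow> 'x \<Rightarrow> real) (g :: 'x \<Rightarrow> 'x) (c :: nat \<Rightarrow> complex).
    (\<forall>x y. 0 \<le> \<phi> x y) \<and>
    (\<forall>n. c n \<noteq> 0) \<and>
    (\<forall>x y. norm (ip (f x) y - ip x (g y)) \<le> \<phi> x y) \<and>
    (((\<forall>x y. (\<lambda>n. inverse (cmod (c n)) * \<phi> (scale (c n) x) y) \<longlonglongrightarrow> 0) \<and>
      (\<forall>x y. (\<lambda>n. inverse (cmod (c n)) * \<phi> x (scale (c n) y)) \<longlonglongrightarrow> 0)) \<or>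
     ((\<forall>x y. (\<lambda>n. cmod (c n) * \<phi> (scale (inverse (c n)) x) y) \<longlonglongrightarrow> 0) \<and>
      (\<forall>x y. (\<lambda>n. cmod (c n) * \<phi> x (scale (inverse (c n)) y)) \<longlonglongrightarrow> 0))))"
proof
  interpret hilbert_module scale act ip by fact
  assume "\<exists>(\<phi> :: 'x \<Rightarrow> 'x \<Rightarrow> real) (g :: 'x \<Rightarrow> 'x) (c :: nat \<Rightarrow> complex).
    (\<forall>x y. 0 \<le> \<phi> x y) \<and>
    (\<forall>n. c n \<noteq> 0) \<and>
    (\<forall>x y. norm (ip (f x) y - ip x (g y)) \<le> \<phi> x y) \<and>
    (((\<forall>x y. (\<lambda>n. inverse (cmod (c n)) * \<phi> (scale (c n) x) y) \<longlonglongrightarrow> 0) \<and>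
      (\<forall>x y. (\<lambda>n. inverse (cmod (c n)) * \<phi> x (scale (c n) y)) \<longlonglongrightarrow> 0)) \<or>
     ((\<forall>x y. (\<lambda>n. cmod (c n) * \<phi> (scale (inverse (c n)) x) y) \<longlonglongrightarrow> 0) \<and>
      (\<forall>x y. (\<lambda>n. cmod (c n) * \<phi> x (scale (inverse (c n)) y)) \<longlonglongrightarrow> 0)))"
  then obtain \<phi> :: "'x \<Rightarrow> 'x \<Rightarrow> real" and g :: "'x \<Rightarrow> 'x" and c :: "nat \<Rightarrow> complex"
    where nz: "\<And>n. c n \<noteq> 0"
      and bound: "\<And>x y. norm (ip (f x) y - ip x (g y)) \<le> \<phi> x y"
      and lims: "(\<forall>x y. (\<lambda>n. inverse (cmod (c n)) * \<phi> (scale (c n) x) y) \<longlonglongrightarrow> 0) \<or>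
        (\<forall>x y. (\<lambda>n. cmod (c n) * \<phi> (scale (inverse (c n)) x) y) \<longlonglongrightarrow> 0)"
    by blast
  from lims have "adjointable ip f"
  proof
    assume "\<forall>x y. (\<lambda>n. inverse (cmod (c n)) * \<phi> (scale (c n) x) y) \<longlonglongrightarrow> 0"
    then show ?thesis
      using adjointable_if_approx_adjoint[where d = c and g = g and \<phi> = \<phi>,
          OF \<open>module_linear act f\<close> nz bound] by blast
  next
    assume "\<forall>x y. (\<lambda>n. cmod (c n) * \<phi> (scale (inverse (c n)) x) y) \<longlonglongrightarrow> 0"
    then show ?thesis
      by (intro adjointable_if_approx_adjoint[where d = "\<lambda>n. inverse (c n)" and g = g and \<phi> = \<phi>]
          \<open>module_linear act f\<close> bound) (simp_all add: nz norm_inverse)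
  qed
  with \<open>\<not> adjointable ip f\<close> show False by contradiction
qed

end
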